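(* Let $\mathit{PS}_1=(S_1,\overline{s},\mathit{Act},\mathit{Steps}_1)$ and $\mathit{PS}_2=(S_2,\overline{s},\mathit{Act},\mathit{Steps}_2)$ be two finite probabilistic systems with the same start state $\overline{s}$ and the same action set $\mathit{Act}$. Let $F_1\subseteq S_1$ and $F_2\subseteq S_2$ be sets of target states. Assume: (1) For every state $s\in S_1\cap S_2$ that is a point of disagreement, there exists $t\in S_1\cap S_2$ such that $t$ is not a point of disagreement, and $s\prec_D t$ holds in $\mathit{PS}_1$ and $s\prec_D t$ holds in $\mathit{PS}_2$. (2) $S_1\cap S_2\cap F_1=S_1\cap S_2\cap F_2$, and for every point of disagreement $s\in S_1\cap S_2$, with $t$ the state postulated in (1): for every state $u$ lying on any path in $\mathit{PS}_1$ from $s$ to $t$, $u\in F_1\Rightarrow (s\in F_1)\vee(t\in F_1)$; and for every state $u$ lying on any path in $\mathit{PS}_2$ from $s$ to $t$, $u\in F_2\Rightarrow (s\in F_2)\vee(t\in F_2)$. Then $\mathit{MaxProbReach}^{\mathit{PS}_1}(F_1)=\mathit{MaxProbReach}^{\mathit{PS}_2}(F_2)$ and $\mathit{MinProbReach}^{\mathit{PS}_1}(F_1)=\mathit{MinProbReach}^{\mathit{PS}_2}(F_2)$.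
   Context: All states of the systems considered are taken from a common global set of states, so intersections such as $S_1\cap S_2$ make sense. A probabilistic system (PS) is a tuple $(S,\overline{s},\Sigma,\mathit{Steps})$ with $S$ a finite set of states, $\overline{s}\in S$ the start state, $\Sigma$ a finite set of labels, and $\mathit{Steps}:S\to 2^{\Sigma\times \mathit{Dist}(S)}$, where $\mathit{Dist}(S)$ is the set of probability distributions on $S$. The support of a distribution $\pi$ on a finite set $X$ is $\mathit{supp}(\pi)=\{x\in X:\pi(x)>0\}$. Deterministic dominator: in a PS with state set $S$, $\prec_D$ is the smallest relation on $S\times S$ such that $s\prec_D s$ for all $s$, and for all $s,t\in S$: if for every $(a,\pi)\in\mathit{Steps}(s)$ there is $x$ with $\mathit{supp}(\pi)=\{x\}$ and $x\prec_D t$, then $s\prec_D t$. Two distributions $P_1,P_2$ are equivalent, $P_1\equiv P_2$, if $\mathit{supp}(P_1)=\mathit{supp}(P_2)$ and $P_1(s)=P_2(s)$ for all $s$ in this common support. Two sets of labelled distributions $\mathit{St}_1,\mathit{St}_2$ are equivalent if for every $(a,\mu_1)\in \mathit{St}_1$ there is $(b,\mu_2)\in\mathit{St}_2$ with $\mu_1\equiv\mu_2$, and for every $(a,\mu_2)\in\mathit{St}_2$ there is $(b,\mu_1)\in\mathit{St}_1$ with $\mu_2\equiv\mu_1$ (labels are ignored). A state $s\in S_1\cap S_2$ is a point of disagreement between $\mathit{PS}_1$ and $\mathit{PS}_2$ if $\mathit{Steps}_1(s)$ and $\mathit{Steps}_2(s)$ are not equivalent. A path in a PS is a sequence $(s_1,a_1),(s_2,a_2),\dots,(s_{n+1})$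 such that for each $i\le n$ there is $(a_i,\mu)\in\mathit{Steps}(s_i)$ with $\mu(s_{i+1})>0$; a path from $s$ to $t$ has $s_1=s$, $s_{n+1}=t$. An adversary is a function $A$ mapping each state $s$ to an element $A(s)\in\mathit{Steps}(s)$; it induces a discrete-time Markov chain on $S$ with transition distribution at $s$ given by the distribution of $A(s)$, started at $\overline{s}$. $\mathit{ProbReach}^A(F)$ is the probability, in this Markov chain (standard cylinder-set measure on infinite paths), that some state of $F$ is eventually visited. $\mathit{MaxProbReach}(F)$ and $\mathit{MinProbReach}(F)$ are the supremum and infimum of $\mathit{ProbReach}^A(F)$ over all adversaries $A$.
   Formalization: It is additionally assumed that Steps(s) is nonempty for every state s of both systems; otherwise no adversary exists, so the maximal and minimal reachability probabilities are a supremum and infimum over the empty set and the claim is ill-defined or fails. *)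

theory Defs
  imports "HOL-Probability.Probability"
begin

text \<open>
  The type \<open>'s\<close> is the global set of states. A probability distribution on the state set is a
  \<open>pmf\<close> over \<open>'s\<close> whose support \<open>set_pmf\<close> is contained in the state set.
\<close>

record ('s, 'l) prob_sys =
  states :: "'s set"
  start :: 's
  labels :: "'l set"
  steps :: "'s \<Rightarrow> ('l \<times> 's pmf) set"

definition Dist :: "'s set \<Rightarrow> 's pmf set" where
  "Dist S = {\<pi>. set_pmf \<pi> \<subseteq> S}"

definition prob_system :: "('s, 'l) prob_sys \<Rightarrow> bool" where
  "prob_system PS \<longleftrightarrow>
     finite (states PS) \<and> start PS \<in> states PS \<and> finite (labels PS) \<and>
     (\<forall>s\<in>states PS. steps PS s \<subseteq> labels PS \<times> Dist (states PS))"

inductive det_dom :: "('s, 'l) prob_sys \<Rightarrow> 's \<Rightarrow> 's \<Rightarrow> bool" for PS :: "('s, 'l) prob_sys" where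
  det_dom_refl: "s \<in> states PS \<Longrightarrow> det_dom PS s s"
| det_dom_step: "\<lbrakk>s \<in> states PS; t \<in> states PS;
          \<forall>a \<pi>. (a, \<pi>) \<in> steps PS s \<longrightarrow> (\<exists>x. set_pmf \<pi> = {x} \<and> det_dom PS x t)\<rbrakk>
         \<Longrightarrow> det_dom PS s t"

definition dist_equiv :: "'s pmf \<Rightarrow> 's pmf \<Rightarrow> bool" where
  "dist_equiv P1 P2 \<longleftrightarrow> set_pmf P1 = set_pmf P2 \<and> (\<forall>s\<in>set_pmf P1. pmf P1 s = pmf P2 s)"

definition steps_equiv :: "('l \<times> 's pmf) set \<Rightarrow> ('l \<times> 's pmf) set \<Rightarrow> bool" where
  "steps_equiv St1 St2 \<longleftrightarrow>
     (\<forall>(a, \<mu>1)\<in>St1. \<exists>(b, \<mu>2)\<in>St2. dist_equiv \<mu>1 \<mu>2) \<and>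
     (\<forall>(a, \<mu>2)\<in>St2. \<exists>(b, \<mu>1)\<in>St1. dist_equiv \<mu>2 \<mu>1)"

definition disagreement :: "('s, 'l) prob_sys \<Rightarrow> ('s, 'l) prob_sys \<Rightarrow> 's \<Rightarrow> bool" where
  "disagreement PS1 PS2 s \<longleftrightarrow>
     s \<in> states PS1 \<inter> states PS2 \<and> \<not> steps_equiv (steps PS1 s) (steps PS2 s)"

text \<open>
  The sequence \<open>(s\<^sub>1,a\<^sub>1), \<dots>, (s\<^sub>n,a\<^sub>n), s\<^sub>n\<^sub>+\<^sub>1\<close> is represented by the list of its first \<open>n\<close> entries
  together with the final state.
\<close>

definition path_states :: "('s \<times> 'l) list \<Rightarrow> 's \<Rightarrow> 's list" where
  "path_states p z = map fst p @ [z]"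

definition is_path :: "('s, 'l) prob_sys \<Rightarrow> ('s \<times> 'l) list \<Rightarrow> 's \<Rightarrow> bool" where
  "is_path PS p z \<longleftrightarrow>
     set (path_states p z) \<subseteq> states PS \<and>
     (\<forall>i<length p. \<exists>\<mu>. (snd (p ! i), \<mu>) \<in> steps PS (fst (p ! i)) \<and>
                       pmf \<mu> (path_states p z ! Suc i) > 0)"

definition lies_on_path :: "('s, 'l) prob_sys \<Rightarrow> 's \<Rightarrow> 's \<Rightarrow> 's \<Rightarrow> bool" where
  "lies_on_path PS s t u \<longleftrightarrow>
     (\<exists>p. is_path PS p t \<and> hd (path_states p t) = s \<and> u \<in> set (path_states p t))"

text \<open>
  The path measure of the chain with transition distributions \<open>K\<close> and initial state \<open>s0\<close>, on the
  product sigma-algebra over \<open>nat \<Rightarrow> 's\<close>, is the Ionescu-Tulcea limit of the kernels giving the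
  law of the \<open>n\<close>-th state from the earlier ones. That it is the standard cylinder-set measure is
  proved in \<open>measure_dtmc_cylinder\<close>.
\<close>

definition dtmc_kernel :: "('s \<Rightarrow> 's pmf) \<Rightarrow> 's \<Rightarrow> nat \<Rightarrow> (nat \<Rightarrow> 's) \<Rightarrow> 's measure" where
  "dtmc_kernel K s0 n \<omega> = measure_pmf (case n of 0 \<Rightarrow> return_pmf s0 | Suc m \<Rightarrow> K (\<omega> m))"

definition dtmc :: "('s \<Rightarrow> 's pmf) \<Rightarrow> 's \<Rightarrow> (nat \<Rightarrow> 's) measure" where
  "dtmc K s0 =
     projective_family.lim UNIV
       (Ionescu_Tulcea.CI (dtmc_kernel K s0) (\<lambda>_. count_space UNIV)) (\<lambda>_. count_space UNIV)"

lemma Ionescu_Tulcea_dtmc: "Ionescu_Tulcea (dtmc_kernel K s0) (\<lambda>_. count_space UNIV)"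
proof (rule Ionescu_Tulcea.intro)
  fix i
  show "dtmc_kernel K s0 i \<in> measurable (PiM {0..<i} (\<lambda>_. count_space UNIV))
          (subprob_algebra (count_space UNIV))"
  proof (cases i)
    case 0
    then show ?thesis
      unfolding dtmc_kernel_def by (simp add: measure_pmf_in_subprob_algebra)
  next
    case (Suc m)
    have "(\<lambda>\<omega>. \<omega> m) \<in> measurable (PiM {0..<i} (\<lambda>_. count_space UNIV)) (count_space UNIV)"
      using Suc by (intro measurable_component_singleton) auto
    moreover have "(\<lambda>x. measure_pmf (K x)) \<in>
        measurable (count_space UNIV) (subprob_algebra (count_space UNIV))"
      by (simp add: measure_pmf_in_subprob_algebra)
    ultimately have "(\<lambda>\<omega>. measure_pmf (K (\<omega> m))) \<in>
        measurable (PiM {0..<i} (\<lambda>_. count_space UNIV)) (subprob_algebra (count_space UNIV))"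
      by (rule measurable_compose)
    then show ?thesis
      unfolding dtmc_kernel_def Suc by simp
  qed
next
  fix i x
  show "prob_space (dtmc_kernel K s0 i x)"
    unfolding dtmc_kernel_def by (rule prob_space_measure_pmf)
qed

lemma sets_dtmc [measurable_cong]: "sets (dtmc K s0) = sets (PiM UNIV (\<lambda>_. count_space UNIV))"
proof -
  interpret Ionescu_Tulcea "dtmc_kernel K s0" "\<lambda>_. count_space UNIV"
    by (rule Ionescu_Tulcea_dtmc)
  show ?thesis unfolding dtmc_def by simp
qed

lemma space_dtmc [simp]: "space (dtmc K s0) = UNIV"
  using sets_eq_imp_space_eq[OF sets_dtmc] by (simp add: space_PiM)

lemma emeasure_dtmc_emb:
  assumes "X \<in> sets (PiM {0..<n} (\<lambda>_. count_space UNIV))"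
  shows "emeasure (dtmc K s0) (prod_emb UNIV (\<lambda>_. count_space UNIV) {0..<n} X) =
         emeasure (Ionescu_Tulcea.C (dtmc_kernel K s0) (\<lambda>_. count_space UNIV) 0 n (\<lambda>_. undefined)) X"
proof -
  interpret Ionescu_Tulcea "dtmc_kernel K s0" "\<lambda>_. count_space UNIV"
    by (rule Ionescu_Tulcea_dtmc)
  have "X \<subseteq> extensional {0..<n}"
    using sets.sets_into_space[OF assms] by (auto simp: space_PiM PiE_def)
  then have "prod_emb {0..<n} (\<lambda>_. count_space UNIV) {0..<n} X = X"
    by (auto simp: prod_emb_def space_PiM PiE_def extensional_restrict)
  then show ?thesis
    unfolding dtmc_def using lim[OF _ assms] emeasure_CI[OF order.refl assms] by simp
qed

lemma prob_space_dtmc: "prob_space (dtmc K s0)"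
proof
  interpret Ionescu_Tulcea "dtmc_kernel K s0" "\<lambda>_. count_space UNIV"
    by (rule Ionescu_Tulcea_dtmc)
  interpret C: prob_space "C 0 0 (\<lambda>_. undefined)"
    by (rule prob_space_C) (simp add: space_PiM)
  have "prod_emb UNIV (\<lambda>_. count_space UNIV) {0..<0} {\<lambda>_. undefined} = (UNIV :: (nat \<Rightarrow> 'a) set)"
    by (auto simp: prod_emb_def space_PiM restrict_def)
  then show "emeasure (dtmc K s0) (space (dtmc K s0)) = 1"
    using emeasure_dtmc_emb[of "{\<lambda>_. undefined}" 0 K s0] C.emeasure_space_1
    by (simp add: space_C space_PiM PiM_empty)
qed

lemma singleton_restrict_in_sets:
  "{restrict xs {0..<m}} \<in> sets (PiM {0..<m::nat} (\<lambda>_. count_space UNIV))"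
proof -
  have "{restrict xs {0..<m}} = (\<Pi>\<^sub>E i\<in>{0..<m}. {restrict xs {0..<m} i})"
    by (rule PiE_singleton[symmetric]) simp
  also have "\<dots> \<in> sets (PiM {0..<m} (\<lambda>_. count_space UNIV))"
    by (intro sets_PiM_I_finite) auto
  finally show ?thesis .
qed

lemma emeasure_C_cylinder:
  "emeasure (Ionescu_Tulcea.C (dtmc_kernel K s0) (\<lambda>_. count_space UNIV) 0 (Suc n) (\<lambda>_. undefined))
     {restrict xs {0..<Suc n}} =
   ennreal (if xs 0 = s0 then \<Prod>i<n. pmf (K (xs i)) (xs (Suc i)) else 0)"
proof -
  interpret Ionescu_Tulcea "dtmc_kernel K s0" "\<lambda>_. count_space UNIV"
    by (rule Ionescu_Tulcea_dtmc)
  note sing = singleton_restrict_in_sets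
  have eP: "emeasure (eP m \<omega>) {restrict xs {0..<Suc m}} =
      indicator {restrict xs {0..<m}} \<omega> * emeasure (dtmc_kernel K s0 m (restrict xs {0..<m})) {xs m}"
    if "\<omega> \<in> space (PiM {0..<m} (\<lambda>_. count_space UNIV))" for m \<omega>
  proof -
    have extl: "\<omega> \<in> extensional {0..<m}"
      using that by (simp add: space_PiM PiE_def)
    have upd: "fun_upd \<omega> m x = restrict xs {0..<Suc m} \<longleftrightarrow> \<omega> = restrict xs {0..<m} \<and> x = xs m" for x
    proof
      assume *: "fun_upd \<omega> m x = restrict xs {0..<Suc m}"
      have "\<omega> j = restrict xs {0..<m} j" for j
        using fun_cong[OF *, of j] extl by (cases "j = m") (auto simp: extensional_def)
      then show "\<omega> = restrict xs {0..<m} \<and> x = xs m"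
        using fun_cong[OF *, of m] by auto
    next
      assume "\<omega> = restrict xs {0..<m} \<and> x = xs m"
      then have \<omega>: "\<omega> = restrict xs {0..<m}" and x: "x = xs m" by blast+
      show "fun_upd \<omega> m x = restrict xs {0..<Suc m}"
        unfolding \<omega> x by (rule ext) simp
    qed
    have vim: "fun_upd \<omega> m -` {restrict xs {0..<Suc m}} =
        (if \<omega> = restrict xs {0..<m} then {xs m} else {})"
      by (intro set_eqI) (simp only: vimage_eq singleton_iff upd split: if_split, blast)
    have "emeasure (eP m \<omega>) {restrict xs {0..<Suc m}} =
        emeasure (dtmc_kernel K s0 m \<omega>) (if \<omega> = restrict xs {0..<m} then {xs m} else {})"
      unfolding emeasure_eP[OF that sing] vim by simp
    then show ?thesis
      by (cases "\<omega> = restrict xs {0..<m}") (simp_all only: if_True if_False indicator_simps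
          singleton_iff refl not_False_eq_True emeasure_empty mult_1 mult_zero_left)
  qed
  have C_Suc: "emeasure (C 0 (Suc m) (\<lambda>_. undefined)) {restrict xs {0..<Suc m}} =
      emeasure (C 0 m (\<lambda>_. undefined)) {restrict xs {0..<m}} *
      emeasure (dtmc_kernel K s0 m (restrict xs {0..<m})) {xs m}" for m
  proof -
    have undef: "(\<lambda>_. undefined) \<in> space (PiM {0..<0::nat} (\<lambda>_. count_space (UNIV :: 'a set)))"
      by (simp add: space_PiM)
    have sC: "sets (C 0 m (\<lambda>_. undefined)) = sets (PiM {0..<m} (\<lambda>_. count_space UNIV))"
      using sets_C[OF undef, of m] by simp
    have meas: "eP m \<in> measurable (C 0 m (\<lambda>_. undefined))
        (subprob_algebra (PiM {0..<Suc m} (\<lambda>_. count_space UNIV)))"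
      unfolding measurable_cong_sets[OF sC refl] by (rule measurable_eP)
    have "emeasure (C 0 (Suc m) (\<lambda>_. undefined)) {restrict xs {0..<Suc m}} =
        (\<integral>\<^sup>+\<omega>. emeasure (eP m \<omega>) {restrict xs {0..<Suc m}} \<partial>C 0 m (\<lambda>_. undefined))"
      using emeasure_bind[OF prob_space.not_empty[OF prob_space_C[OF undef, of m]] meas sing] by simp
    also have "\<dots> = (\<integral>\<^sup>+\<omega>. emeasure (dtmc_kernel K s0 m (restrict xs {0..<m})) {xs m} *
        indicator {restrict xs {0..<m}} \<omega> \<partial>C 0 m (\<lambda>_. undefined))"
      using space_C[OF undef, of m] by (intro nn_integral_cong) (simp add: eP mult.commute)
    also have "\<dots> = emeasure (dtmc_kernel K s0 m (restrict xs {0..<m})) {xs m} *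
        emeasure (C 0 m (\<lambda>_. undefined)) {restrict xs {0..<m}}"
      by (intro nn_integral_cmult_indicator) (simp only: sC sing)
    finally show ?thesis by (simp add: mult.commute)
  qed
  show ?thesis
  proof (induction n)
    case 0
    interpret C: prob_space "C 0 0 (\<lambda>_. undefined)"
      by (rule prob_space_C) (simp add: space_PiM)
    have "emeasure (C 0 0 (\<lambda>_. undefined)) {restrict xs {0..<0}} = 1"
      using C.emeasure_space_1 by (simp add: space_C space_PiM restrict_def)
    then show ?case
      unfolding C_Suc[of 0] by (simp add: dtmc_kernel_def emeasure_pmf_single indicator_def)
  next
    case (Suc n)
    show ?case
      unfolding C_Suc[of "Suc n"] Suc
      by (simp add: dtmc_kernel_def emeasure_pmf_single prod_nonneg flip: ennreal_mult)
  qed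
qed

lemma restrict_Suc_eq_iff:
  "restrict \<omega> {0..<Suc n} = restrict xs {0..<Suc n} \<longleftrightarrow> (\<forall>i\<le>n. \<omega> i = xs i)"
proof
  assume *: "restrict \<omega> {0..<Suc n} = restrict xs {0..<Suc n}"
  show "\<forall>i\<le>n. \<omega> i = xs i"
  proof (intro allI impI)
    fix i assume "i \<le> n"
    then show "\<omega> i = xs i" using fun_cong[OF *, of i] by simp
  qed
qed (intro ext, simp add: restrict_def)

lemma measure_dtmc_cylinder:
  "measure (dtmc K s0) {\<omega>. \<forall>i\<le>n. \<omega> i = xs i} =
     (if xs 0 = s0 then \<Prod>i<n. pmf (K (xs i)) (xs (Suc i)) else 0)"
proof -
  have "{restrict xs {0..<Suc n}} \<in> sets (PiM {0..<Suc n} (\<lambda>_. count_space UNIV))"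
    by (rule singleton_restrict_in_sets)
  moreover have "prod_emb UNIV (\<lambda>_. count_space UNIV) {0..<Suc n} {restrict xs {0..<Suc n}} =
      {\<omega>. \<forall>i\<le>n. \<omega> i = xs i}"
    by (simp add: prod_emb_def space_PiM vimage_def restrict_Suc_eq_iff del: restrict_apply)
  ultimately have "emeasure (dtmc K s0) {\<omega>. \<forall>i\<le>n. \<omega> i = xs i} =
      ennreal (if xs 0 = s0 then \<Prod>i<n. pmf (K (xs i)) (xs (Suc i)) else 0)"
    using emeasure_dtmc_emb[of "{restrict xs {0..<Suc n}}" "Suc n" K s0]
      emeasure_C_cylinder[of K s0 n xs] by simp
  then show ?thesis
    by (simp add: measure_def prod_nonneg)
qed

lemma sets_dtmc_reach [measurable]: "{\<omega>. \<exists>n. \<omega> n \<in> F} \<in> sets (dtmc K s0)"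
proof -
  have "{\<omega>. \<omega> n \<in> F} \<in> sets (dtmc K s0)" for n
  proof -
    have "(\<lambda>\<omega>. \<omega> n) \<in> measurable (dtmc K s0) (count_space UNIV)"
      unfolding measurable_cong_sets[OF sets_dtmc refl]
      by (rule measurable_component_singleton) simp
    from measurable_sets[OF this, of F] show ?thesis by (simp add: vimage_def)
  qed
  then have "(\<Union>n. {\<omega>. \<omega> n \<in> F}) \<in> sets (dtmc K s0)"
    by (intro sets.countable_UN) auto
  also have "(\<Union>n. {\<omega>. \<omega> n \<in> F}) = {\<omega>. \<exists>n. \<omega> n \<in> F}"
    by auto
  finally show ?thesis .
qed

text \<open>
  There is an adversary only if every state has at least one step; otherwise \<open>MaxProbReach\<close> and
  \<open>MinProbReach\<close> are the unspecified supremum and infimum of the empty set of reals.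
\<close>

definition adversaries :: "('s, 'l) prob_sys \<Rightarrow> ('s \<Rightarrow> 'l \<times> 's pmf) set" where
  "adversaries PS = (\<Pi>\<^sub>E s\<in>states PS. steps PS s)"

definition ProbReach :: "('s, 'l) prob_sys \<Rightarrow> ('s \<Rightarrow> 'l \<times> 's pmf) \<Rightarrow> 's set \<Rightarrow> real" where
  "ProbReach PS A F = measure (dtmc (\<lambda>s. snd (A s)) (start PS)) {\<omega>. \<exists>n. \<omega> n \<in> F}"

definition MaxProbReach :: "('s, 'l) prob_sys \<Rightarrow> 's set \<Rightarrow> real" where
  "MaxProbReach PS F = (SUP A\<in>adversaries PS. ProbReach PS A F)"

definition MinProbReach :: "('s, 'l) prob_sys \<Rightarrow> 's set \<Rightarrow> real" where
  "MinProbReach PS F = (INF A\<in>adversaries PS. ProbReach PS A F)"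

end

theory Submission
  imports Defs
begin

text \<open>
  An adversary \<open>A\<close> of one system is transferred to the other by copying its choices at the states of
  agreement and choosing arbitrarily elsewhere. The two induced chains then reach their targets with
  the same probability from every common state: at a state of agreement they make the same move,
  which stays within the common states; and from a point of disagreement outside the target both
  are forced to run to the dominating state of agreement, meeting no target before it. So no theory
  of optimal adversaries is needed: the two systems have the same set of reachability probabilities.
\<close>

subsection \<open>Bounded reachability in a Markov chain\<close>

text \<open>First-step recursion for the probability of visiting \<open>F\<close> within
  \<open>n\<close> steps, with \<open>F\<close> made absorbing. Values lie in
  \<open>ennreal\<close>, so averages are nonnegative integrals and limits are plain
  suprema.\<close>

primrec bounded_reach :: "('s \<Rightarrow> 's pmf) \<Rightarrow> 's set \<Rightarrow> nat \<Rightarrow> 's \<Rightarrow> ennreal" where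
  "bounded_reach K F 0 s = indicator F s"
| "bounded_reach K F (Suc n) s =
     (if s \<in> F then 1 else \<integral>\<^sup>+x. bounded_reach K F n x \<partial>measure_pmf (K s))"

lemma bounded_reach_target [simp]: "s \<in> F \<Longrightarrow> bounded_reach K F n s = 1"
  by (cases n) auto

lemma bounded_reach_le_1: "bounded_reach K F n s \<le> 1"
proof (induction n arbitrary: s)
  case 0
  show ?case by (simp add: indicator_def)
next
  case (Suc n)
  have "(\<integral>\<^sup>+x. bounded_reach K F n x \<partial>measure_pmf (K s)) \<le> (\<integral>\<^sup>+x. 1 \<partial>measure_pmf (K s))"
    by (intro nn_integral_mono Suc.IH)
  then show ?case by simp
qed

lemma bounded_reach_Suc_mono: "bounded_reach K F n s \<le> bounded_reach K F (Suc n) s"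
proof (induction n arbitrary: s)
  case 0
  show ?case by (simp add: indicator_def)
next
  case (Suc n)
  have "(\<integral>\<^sup>+x. bounded_reach K F n x \<partial>measure_pmf (K s)) \<le>
      (\<integral>\<^sup>+x. bounded_reach K F (Suc n) x \<partial>measure_pmf (K s))"
    by (intro nn_integral_mono Suc.IH)
  then show ?case
    unfolding bounded_reach.simps(2)[of K F "Suc n" s] bounded_reach.simps(2)[of K F n s]
    by (simp del: bounded_reach.simps)
qed

lemma incseq_bounded_reach: "incseq (bounded_reach K F)"
  by (intro incseq_SucI le_funI bounded_reach_Suc_mono)

section \<open>From the recursion to the path measure\<close>

text \<open>The integrand is the conditional probability of a visit by time \<open>m + n\<close>,
  given the states at times \<open>0\<close> to \<open>m\<close>. Integrating out the last state
  trades one path step for one step of the recursion, so only the total horizon counts.\<close>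

lemma nn_integral_dtmc_C_eq_bounded_reach:
  "(\<integral>\<^sup>+\<omega>. (if \<exists>i\<le>m. \<omega> i \<in> F then 1 else bounded_reach K F n (\<omega> m))
      \<partial>Ionescu_Tulcea.C (dtmc_kernel K s0) (\<lambda>_. count_space UNIV) 0 (Suc m) (\<lambda>_. undefined)) =
   bounded_reach K F (m + n) s0"
proof -
  interpret Ionescu_Tulcea "dtmc_kernel K s0" "\<lambda>_. count_space UNIV"
    by (rule Ionescu_Tulcea_dtmc)
  define f where
    "f m n \<omega> = (if \<exists>i\<le>m. \<omega> i \<in> F then 1 else bounded_reach K F n (\<omega> m))" for m n :: nat and \<omega>
  have undef: "(\<lambda>_. undefined) \<in> space (PiM {0..<0::nat} (\<lambda>_. count_space (UNIV :: 'a set)))"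
    by (simp add: space_PiM)
  have f_meas: "f m n \<in> borel_measurable (PiM {0..<Suc m} (\<lambda>_. count_space UNIV))" for m n
  proof -
    have comp: "(\<lambda>\<omega>. \<omega> i) \<in> measurable (PiM {0..<Suc m} (\<lambda>_. count_space UNIV)) (count_space UNIV)"
      if "i \<le> m" for i
      using that by (intro measurable_component_singleton) auto
    have hit: "Measurable.pred (PiM {0..<Suc m} (\<lambda>_. count_space UNIV)) (\<lambda>\<omega>. \<exists>i\<in>{..m}. \<omega> i \<in> F)"
      by (intro pred_intros_finite measurable_compose[OF comp]) auto
    have last: "(\<lambda>\<omega>. bounded_reach K F n (\<omega> m)) \<in>
        borel_measurable (PiM {0..<Suc m} (\<lambda>_. count_space UNIV))"
      by (intro measurable_compose[OF comp]) auto
    show ?thesis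
      unfolding f_def
      by (rule measurable_If[OF measurable_const last
            hit[unfolded Bex_def atMost_iff pred_def]]) simp
  qed
  have step: "(\<integral>\<^sup>+\<omega>. f m n \<omega> \<partial>C 0 (Suc m) (\<lambda>_. undefined)) =
      (\<integral>\<^sup>+\<omega>. (\<integral>\<^sup>+x. f m n (fun_upd \<omega> m x) \<partial>dtmc_kernel K s0 m \<omega>) \<partial>C 0 m (\<lambda>_. undefined))" for m n
  proof -
    have sC: "sets (C 0 m (\<lambda>_. undefined)) = sets (PiM {0..<m} (\<lambda>_. count_space UNIV))"
      using sets_C[OF undef, of m] by simp
    have meas: "eP m \<in> measurable (C 0 m (\<lambda>_. undefined))
        (subprob_algebra (PiM {0..<Suc m} (\<lambda>_. count_space UNIV)))"
      unfolding measurable_cong_sets[OF sC refl] by (rule measurable_eP)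
    have "(\<integral>\<^sup>+\<omega>. f m n \<omega> \<partial>C 0 (Suc m) (\<lambda>_. undefined)) =
        (\<integral>\<^sup>+\<omega>. (\<integral>\<^sup>+\<omega>'. f m n \<omega>' \<partial>eP m \<omega>) \<partial>C 0 m (\<lambda>_. undefined))"
      using nn_integral_bind[OF f_meas meas] by simp
    also have "\<dots> = (\<integral>\<^sup>+\<omega>. (\<integral>\<^sup>+x. f m n (fun_upd \<omega> m x) \<partial>dtmc_kernel K s0 m \<omega>)
        \<partial>C 0 m (\<lambda>_. undefined))"
      using space_C[OF undef, of m] f_meas by (intro nn_integral_cong nn_integral_eP) simp_all
    finally show ?thesis .
  qed
  have "(\<integral>\<^sup>+\<omega>. f m n \<omega> \<partial>C 0 (Suc m) (\<lambda>_. undefined)) = bounded_reach K F (m + n) s0"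
  proof (induction m arbitrary: n)
    case 0
    interpret C0: prob_space "C 0 0 (\<lambda>_. undefined)"
      by (rule prob_space_C[OF undef])
    show ?case
      unfolding step[of 0]
      by (cases "s0 \<in> F") (simp_all add: dtmc_kernel_def f_def C0.emeasure_space_1 del: C.simps)
  next
    case (Suc m)
    have "(\<integral>\<^sup>+x. f (Suc m) n (fun_upd \<omega> (Suc m) x) \<partial>measure_pmf (K (\<omega> m))) = f m (Suc n) \<omega>" for \<omega>
    proof -
      \<comment> \<open>If the new state \<open>x\<close> is a target, \<open>bounded_reach\<close>
        at \<open>x\<close> is already 1, so it needs no branch of its own.\<close>
      have upd: "f (Suc m) n (fun_upd \<omega> (Suc m) x) =
          (if \<exists>i\<le>m. \<omega> i \<in> F then 1 else bounded_reach K F n x)" for x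
      proof -
        have "(\<exists>i\<le>Suc m. fun_upd \<omega> (Suc m) x i \<in> F) \<longleftrightarrow>
            (\<exists>i\<le>m. fun_upd \<omega> (Suc m) x i \<in> F) \<or> x \<in> F"
          by (metis fun_upd_same le_Suc_eq)
        also have "(\<exists>i\<le>m. fun_upd \<omega> (Suc m) x i \<in> F) \<longleftrightarrow> (\<exists>i\<le>m. \<omega> i \<in> F)"
          by (intro ex_cong1 conj_cong refl) auto
        finally have "(\<exists>i\<le>Suc m. fun_upd \<omega> (Suc m) x i \<in> F) \<longleftrightarrow>
            (\<exists>i\<le>m. \<omega> i \<in> F) \<or> x \<in> F" .
        then show ?thesis
          by (cases "x \<in> F")
            (simp_all only: f_def fun_upd_same bounded_reach_target if_True if_cancel simp_thms)
      qed
      show ?thesis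
      proof (cases "\<exists>i\<le>m. \<omega> i \<in> F")
        case True
        then show ?thesis unfolding upd unfolding f_def if_P[OF True] by simp
      next
        case False
        then have "\<omega> m \<notin> F" by blast
        then show ?thesis unfolding upd unfolding f_def if_not_P[OF False] by simp
      qed
    qed
    moreover have "dtmc_kernel K s0 (Suc m) \<omega> = measure_pmf (K (\<omega> m))" for \<omega>
      by (simp add: dtmc_kernel_def)
    \<comment> \<open>The last path step has been absorbed into the recursion, so the induction
      hypothesis is taken at the longer horizon \<open>Suc n\<close>.\<close>
    ultimately show ?case
      unfolding step[of "Suc m"] using Suc.IH[of "Suc n"]
      by (simp only: add_Suc_right add_Suc_shift)
  qed
  then show ?thesis unfolding f_def .
qed

text \<open>The event depends on the first \<open>Suc n\<close> coordinates only, so its measure can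
  be computed in the finite-dimensional law.\<close>

lemma emeasure_dtmc_bounded_reach:
  "emeasure (dtmc K s0) {\<omega>. \<exists>i\<le>n. \<omega> i \<in> F} = bounded_reach K F n s0"
proof -
  interpret Ionescu_Tulcea "dtmc_kernel K s0" "\<lambda>_. count_space UNIV"
    by (rule Ionescu_Tulcea_dtmc)
  let ?P = "PiM {0..<Suc n} (\<lambda>_. count_space UNIV) :: (nat \<Rightarrow> 'a) measure"
  let ?C = "C 0 (Suc n) (\<lambda>_. undefined)"
  let ?X = "{\<omega> \<in> space ?P. \<exists>i\<le>n. \<omega> i \<in> F}"
  have undef: "(\<lambda>_. undefined) \<in> space (PiM {0..<0::nat} (\<lambda>_. count_space (UNIV :: 'a set)))"
    by (simp add: space_PiM)
  have "Measurable.pred ?P (\<lambda>\<omega>. \<omega> i \<in> F)" if "i \<le> n" for i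
    using that by (intro measurable_compose[OF measurable_component_singleton]) auto
  then have "Measurable.pred ?P (\<lambda>\<omega>. \<exists>i\<in>{..n}. \<omega> i \<in> F)"
    by (intro pred_intros_finite) auto
  then have X: "?X \<in> sets ?P"
    unfolding Bex_def atMost_iff pred_def .
  have sC: "sets ?C = sets ?P"
    using sets_C[OF undef, of "Suc n"] by simp
  have "restrict \<omega> {0..<Suc n} \<in> ?X \<longleftrightarrow> (\<exists>i\<le>n. \<omega> i \<in> F)" for \<omega>
  proof -
    have "(\<exists>i\<le>n. restrict \<omega> {0..<Suc n} i \<in> F) \<longleftrightarrow> (\<exists>i\<le>n. \<omega> i \<in> F)"
      by (intro ex_cong1 conj_cong refl) auto
    moreover have "restrict \<omega> {0..<Suc n} \<in> space ?P"
      by (simp add: space_PiM)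
    ultimately show ?thesis by blast
  qed
  then have "{\<omega>. \<exists>i\<le>n. \<omega> i \<in> F} = prod_emb UNIV (\<lambda>_. count_space UNIV) {0..<Suc n} ?X"
    unfolding prod_emb_def by (auto simp only: vimage_def space_count_space PiE_UNIV_domain)
  then have "emeasure (dtmc K s0) {\<omega>. \<exists>i\<le>n. \<omega> i \<in> F} = emeasure ?C ?X"
    by (simp only: emeasure_dtmc_emb[OF X])
  also have "\<dots> = (\<integral>\<^sup>+\<omega>. indicator ?X \<omega> \<partial>?C)"
    by (rule nn_integral_indicator[symmetric]) (unfold sC, rule X)
  \<comment> \<open>With no steps left, \<open>bounded_reach K F 0\<close> is the indicator of
    \<open>F\<close> at the last coordinate, which the first branch covers already.\<close>
  also have "\<dots> = (\<integral>\<^sup>+\<omega>. (if \<exists>i\<le>n. \<omega> i \<in> F then 1 else bounded_reach K F 0 (\<omega> n)) \<partial>?C)"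
  proof (rule nn_integral_cong)
    fix \<omega> assume "\<omega> \<in> space ?C"
    then have "\<omega> \<in> ?X \<longleftrightarrow> (\<exists>i\<le>n. \<omega> i \<in> F)"
      unfolding sets_eq_imp_space_eq[OF sC] by blast
    then show "indicator ?X \<omega> =
        (if \<exists>i\<le>n. \<omega> i \<in> F then 1 else bounded_reach K F 0 (\<omega> n))"
      unfolding indicator_def bounded_reach.simps by auto
  qed
  also have "\<dots> = bounded_reach K F n s0"
    using nn_integral_dtmc_C_eq_bounded_reach[where m = n and n = 0] by (simp only: add_0_right)
  finally show ?thesis .
qed

section \<open>Eventual reachability and its first-step equation\<close>

definition eventual_reach :: "('s \<Rightarrow> 's pmf) \<Rightarrow> 's set \<Rightarrow> 's \<Rightarrow> ennreal" where
  "eventual_reach K F s = (SUP n. bounded_reach K F n s)"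

text \<open>Continuity from below along the increasing events of a visit by time
  \<open>n\<close>.\<close>

lemma emeasure_dtmc_reach:
  "emeasure (dtmc K s0) {\<omega>. \<exists>n. \<omega> n \<in> F} = eventual_reach K F s0"
proof -
  have "{\<omega>. \<exists>i\<le>n. \<omega> i \<in> F} \<in> sets (dtmc K s0)" for n
  proof -
    have comp: "(\<lambda>\<omega>. \<omega> i) \<in> measurable (dtmc K s0) (count_space UNIV)" for i
      unfolding measurable_cong_sets[OF sets_dtmc refl]
      by (rule measurable_component_singleton) simp
    have "(\<Union>i\<in>{..n}. (\<lambda>\<omega>. \<omega> i) -` F \<inter> space (dtmc K s0)) \<in> sets (dtmc K s0)"
      by (rule sets.finite_UN[OF finite_atMost], rule measurable_sets[OF comp]) simp
    also have "(\<Union>i\<in>{..n}. (\<lambda>\<omega>. \<omega> i) -` F \<inter> space (dtmc K s0)) = {\<omega>. \<exists>i\<le>n. \<omega> i \<in> F}"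
      by auto
    finally show ?thesis .
  qed
  moreover have "incseq (\<lambda>n. {\<omega> :: nat \<Rightarrow> 'a. \<exists>i\<le>n. \<omega> i \<in> F})"
    by (intro incseq_SucI) (auto intro: le_SucI)
  ultimately have "(SUP n. emeasure (dtmc K s0) {\<omega>. \<exists>i\<le>n. \<omega> i \<in> F}) =
      emeasure (dtmc K s0) (\<Union>n. {\<omega>. \<exists>i\<le>n. \<omega> i \<in> F})"
    by (intro SUP_emeasure_incseq) auto
  moreover have "(\<Union>n::nat. {\<omega>. \<exists>i\<le>n. \<omega> i \<in> F}) = {\<omega>. \<exists>n. \<omega> n \<in> F}"
    by auto
  ultimately show ?thesis
    by (simp add: eventual_reach_def emeasure_dtmc_bounded_reach)
qed

lemma ProbReach_eq_eventual_reach: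
  "ProbReach PS A F = enn2real (eventual_reach (\<lambda>s. snd (A s)) F (start PS))"
  by (simp add: ProbReach_def measure_def emeasure_dtmc_reach)

lemma bounded_reach_le_eventual_reach: "bounded_reach K F n s \<le> eventual_reach K F s"
  unfolding eventual_reach_def by (rule SUP_upper) simp

lemma eventual_reach_le_1: "eventual_reach K F s \<le> 1"
  unfolding eventual_reach_def by (intro SUP_least bounded_reach_le_1)

lemma eventual_reach_target: "s \<in> F \<Longrightarrow> eventual_reach K F s = 1"
  by (simp add: eventual_reach_def)

lemma eventual_reach_step:
  assumes "s \<notin> F"
  shows "eventual_reach K F s = (\<integral>\<^sup>+x. eventual_reach K F x \<partial>measure_pmf (K s))"
proof -
  \<comment> \<open>Monotonicity in the horizon allows the index to be shifted; the recursion and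
    monotone convergence then apply.\<close>
  have "(SUP n. bounded_reach K F n s) = (SUP n. bounded_reach K F (Suc n) s)"
    by (intro antisym SUP_mono) (blast intro: bounded_reach_Suc_mono)+
  also have "\<dots> = (SUP n. \<integral>\<^sup>+x. bounded_reach K F n x \<partial>measure_pmf (K s))"
    using assms by simp
  also have "\<dots> = (\<integral>\<^sup>+x. (SUP n. bounded_reach K F n x) \<partial>measure_pmf (K s))"
    by (rule nn_integral_monotone_convergence_SUP[symmetric])
      (auto intro: incseq_bounded_reach)
  finally show ?thesis by (simp add: eventual_reach_def)
qed

subsection \<open>Adversaries and deterministic domination\<close>

text \<open>Both distributions vanish off their common support, so agreement on the support is
  agreement everywhere.\<close>

lemma dist_equiv_iff_eq: "dist_equiv P Q \<longleftrightarrow> P = Q"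
proof
  assume *: "dist_equiv P Q"
  show "P = Q"
  proof (rule pmf_eqI)
    fix x
    show "pmf P x = pmf Q x"
      using * by (cases "x \<in> set_pmf P") (auto simp: dist_equiv_def set_pmf_iff)
  qed
qed (simp add: dist_equiv_def)

lemma steps_equiv_iff: "steps_equiv St1 St2 \<longleftrightarrow> snd ` St1 = snd ` St2"
proof -
  have "(\<forall>(a, \<mu>)\<in>X. \<exists>(b, \<nu>)\<in>Y. \<mu> = \<nu>) \<longleftrightarrow> snd ` X \<subseteq> snd ` Y" for X Y :: "('a \<times> 'b pmf) set"
    by (simp add: image_subset_iff image_iff case_prod_beta)
  then show ?thesis
    unfolding steps_equiv_def dist_equiv_iff_eq set_eq_subset by simp
qed

lemma disagreement_sym: "disagreement PS1 PS2 s \<longleftrightarrow> disagreement PS2 PS1 s"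
  by (auto simp: disagreement_def steps_equiv_iff)

lemma adversary_in_steps: "A \<in> adversaries PS \<Longrightarrow> s \<in> states PS \<Longrightarrow> A s \<in> steps PS s"
  by (auto simp: adversaries_def)

text \<open>Keeps the induced chain inside the system; applied to both systems, it shows that a
  shared move leads to a common state.\<close>

lemma set_pmf_adversary_subset:
  assumes "prob_system PS" "A \<in> adversaries PS" "s \<in> states PS"
  shows "set_pmf (snd (A s)) \<subseteq> states PS"
  using adversary_in_steps[OF assms(2,3)] assms(1,3)
  by (cases "A s") (auto simp: prob_system_def Dist_def)

section \<open>Prolonging paths\<close>

text \<open>One step is prepended to a path. The second conclusion is what turns absence of targets
  on paths into \<open>s \<notin> F\<close>.\<close>

lemma lies_on_path_Cons:
  assumes "s \<in> states PS" "(a, \<mu>) \<in> steps PS s" "x \<in> set_pmf \<mu>" "lies_on_path PS x t u"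
  shows "lies_on_path PS s t u" "lies_on_path PS s t s"
proof -
  obtain p where p: "is_path PS p t" "hd (path_states p t) = x" "u \<in> set (path_states p t)"
    using assms(4) by (auto simp: lies_on_path_def)
  \<comment> \<open>This holds also for empty \<open>p\<close>, where the first state is
    \<open>t\<close> itself.\<close>
  have first: "path_states p t ! 0 = x"
    using p(2) by (metis hd_conv_nth path_states_def snoc_eq_iff_butlast)
  have path: "is_path PS ((s, a) # p) t"
    unfolding is_path_def
  proof (intro conjI allI impI)
    show "set (path_states ((s, a) # p) t) \<subseteq> states PS"
      using p(1) assms(1) by (auto simp: is_path_def path_states_def)
  next
    fix i assume i: "i < length ((s, a) # p)"
    show "\<exists>\<mu>. (snd (((s, a) # p) ! i), \<mu>) \<in> steps PS (fst (((s, a) # p) ! i)) \<and>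
              pmf \<mu> (path_states ((s, a) # p) t ! Suc i) > 0"
    proof (cases i)
      case 0
      have "pmf \<mu> (path_states ((s, a) # p) t ! 1) > 0"
        using assms(3) first by (simp add: path_states_def pmf_positive)
      then show ?thesis using 0 assms(2) by auto
    next
      case (Suc j)
      then show ?thesis
        using p(1) i by (auto simp: is_path_def path_states_def)
    qed
  qed
  show "lies_on_path PS s t u" "lies_on_path PS s t s"
    unfolding lies_on_path_def by (rule exI[of _ "(s, a) # p"], use path p(3) in
        \<open>simp add: path_states_def\<close>)+
qed

lemma lies_on_path_refl: "s \<in> states PS \<Longrightarrow> lies_on_path PS s s s"
  unfolding lies_on_path_def
  by (rule exI[of _ "[]"]) (simp add: is_path_def path_states_def)

section \<open>Forced moves under domination\<close>

text \<open>Every choice available at \<open>s\<close> is a point mass, whichever the adversary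
  takes. \<open>P\<close> is general so that an induction hypothesis about the successor can be
  carried along.\<close>

lemma det_dom_adversary_step:
  assumes "A \<in> adversaries PS" "s \<in> states PS"
    and "\<forall>a \<pi>. (a, \<pi>) \<in> steps PS s \<longrightarrow> (\<exists>x. set_pmf \<pi> = {x} \<and> P x)"
  obtains x where "snd (A s) = return_pmf x" "P x"
proof -
  have "(fst (A s), snd (A s)) \<in> steps PS s"
    using adversary_in_steps[OF assms(1,2)] by simp
  then obtain x where "set_pmf (snd (A s)) = {x}" "P x"
    using assms(3) by blast
  then show ?thesis using that by (metis order.refl set_pmf_subset_singleton)
qed

text \<open>Off the target the chain moves surely to a state whose value is at least that of
  \<open>t\<close>, and the first-step equation passes this back to \<open>s\<close>; on the target
  the value is already maximal.\<close>

lemma det_dom_eventual_reach_mono: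
  assumes "det_dom PS s t" "A \<in> adversaries PS"
  shows "eventual_reach (\<lambda>s. snd (A s)) F t \<le> eventual_reach (\<lambda>s. snd (A s)) F s"
  using assms(1)
proof (induction rule: det_dom.induct)
  case (det_dom_step s t)
  obtain x where x: "snd (A s) = return_pmf x"
    "eventual_reach (\<lambda>s. snd (A s)) F t \<le> eventual_reach (\<lambda>s. snd (A s)) F x"
    using det_dom_step.IH by (elim det_dom_adversary_step[OF assms(2) det_dom_step.hyps(1), rotated])
      blast
  show ?case
  proof (cases "s \<in> F")
    case True
    then show ?thesis by (simp add: eventual_reach_target eventual_reach_le_1)
  next
    case False
    then show ?thesis using x by (simp add: eventual_reach_step[of s])
  qed
qed simp

text \<open>The opposite bound when no target lies on the way: a visit to \<open>F\<close> from
  \<open>s\<close> must come after \<open>t\<close>, and the steps spent before \<open>t\<close>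
  only shorten the remaining horizon.\<close>

lemma det_dom_bounded_reach_le:
  assumes "det_dom PS s t" "A \<in> adversaries PS" "t \<notin> F"
    and "\<And>u. lies_on_path PS s t u \<Longrightarrow> u \<notin> F"
  shows "bounded_reach (\<lambda>s. snd (A s)) F n s \<le> bounded_reach (\<lambda>s. snd (A s)) F n t"
proof -
  let ?K = "\<lambda>s. snd (A s)"
  \<comment> \<open>Existence of a path is added to the claim: otherwise the condition on all paths
    could be vacuous and say nothing about \<open>s\<close>. The conditions on \<open>F\<close> and
    the quantifier over \<open>n\<close> stand inside because the induction hypothesis concerns the
    successor at a smaller horizon.\<close>
  have "(\<exists>u. lies_on_path PS s t u) \<and>
      (t \<notin> F \<longrightarrow> (\<forall>u. lies_on_path PS s t u \<longrightarrow> u \<notin> F) \<longrightarrow>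
        (\<forall>n. bounded_reach ?K F n s \<le> bounded_reach ?K F n t))"
    using assms(1)
  proof (induction rule: det_dom.induct)
    case (det_dom_refl s)
    then have "lies_on_path PS s s s" by (rule lies_on_path_refl)
    then show ?case by auto
  next
    case (det_dom_step s t)
    let ?Q = "\<lambda>x. (\<exists>u. lies_on_path PS x t u) \<and>
      (t \<notin> F \<longrightarrow> (\<forall>u. lies_on_path PS x t u \<longrightarrow> u \<notin> F) \<longrightarrow>
        (\<forall>n. bounded_reach ?K F n x \<le> bounded_reach ?K F n t))"
    obtain x where x: "?K s = return_pmf x" "?Q x"
      using det_dom_step.IH
      by (elim det_dom_adversary_step[OF assms(2) det_dom_step.hyps(1), rotated]) blast
    have As: "(fst (A s), ?K s) \<in> steps PS s"
      using adversary_in_steps[OF assms(2) det_dom_step.hyps(1)] by simp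
    have Cons: "lies_on_path PS s t u" "lies_on_path PS s t s" if "lies_on_path PS x t u" for u
      using lies_on_path_Cons[OF det_dom_step.hyps(1) As _ that] x(1) by auto
    have "bounded_reach ?K F n s \<le> bounded_reach ?K F n t"
      if F: "t \<notin> F" "\<forall>u. lies_on_path PS s t u \<longrightarrow> u \<notin> F" for n
    proof (cases n)
      case 0
      have "s \<notin> F" using F(2) Cons x(2) by blast
      then show ?thesis using 0 by simp
    next
      case (Suc m)
      have "s \<notin> F" using F(2) Cons x(2) by blast
      then have "bounded_reach ?K F n s = bounded_reach ?K F m x"
        using x(1) Suc by simp
      also have "\<dots> \<le> bounded_reach ?K F m t"
        using x(2) F Cons by blast
      also have "\<dots> \<le> bounded_reach ?K F n t"
        unfolding Suc by (rule bounded_reach_Suc_mono)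
      finally show ?thesis .
    qed
    then show ?case using x(2) Cons by blast
  qed
  then show ?thesis using assms(3,4) by blast
qed

subsection \<open>Transfer of adversaries\<close>

text \<open>Gathers the conditions on domination and targets in a form invariant under exchanging
  the systems, so that each one-sided result also yields its converse.\<close>

definition dominated_disagreement ::
  "('s, 'l) prob_sys \<Rightarrow> ('s, 'l) prob_sys \<Rightarrow> 's set \<Rightarrow> 's set \<Rightarrow> ('s \<Rightarrow> 's) \<Rightarrow> bool" where
  "dominated_disagreement PS1 PS2 F1 F2 t \<longleftrightarrow>
     states PS1 \<inter> states PS2 \<inter> F1 = states PS1 \<inter> states PS2 \<inter> F2 \<and>
     (\<forall>s. disagreement PS1 PS2 s \<longrightarrow>
        t s \<in> states PS1 \<inter> states PS2 \<and> \<not> disagreement PS1 PS2 (t s) \<and>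
        det_dom PS1 s (t s) \<and> det_dom PS2 s (t s) \<and>
        (\<forall>u. lies_on_path PS1 s (t s) u \<longrightarrow> u \<in> F1 \<longrightarrow> s \<in> F1 \<or> t s \<in> F1) \<and>
        (\<forall>u. lies_on_path PS2 s (t s) u \<longrightarrow> u \<in> F2 \<longrightarrow> s \<in> F2 \<or> t s \<in> F2))"

lemma dominated_disagreement_sym:
  assumes "dominated_disagreement PS1 PS2 F1 F2 t"
  shows "dominated_disagreement PS2 PS1 F2 F1 t"
  using assms unfolding dominated_disagreement_def disagreement_sym[of PS2 PS1] by blast

text \<open>Induction on the horizon of the first chain against the unbounded value of the second,
  which satisfies the first-step equation. At a point of disagreement the comparison is made at
  \<open>t s\<close> and carried back by domination in each system.\<close>

lemma bounded_reach_le_other: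
  assumes D: "dominated_disagreement PS1 PS2 F1 F2 t"
    and sys: "prob_system PS1" "prob_system PS2"
    and A: "A \<in> adversaries PS1" and B: "B \<in> adversaries PS2"
    and same: "\<And>s. s \<in> states PS1 \<Longrightarrow> s \<in> states PS2 \<Longrightarrow> \<not> disagreement PS1 PS2 s \<Longrightarrow>
      snd (A s) = snd (B s)"
    and s: "s \<in> states PS1" "s \<in> states PS2"
  shows "bounded_reach (\<lambda>s. snd (A s)) F1 n s \<le> eventual_reach (\<lambda>s. snd (B s)) F2 s"
proof -
  have target_iff: "s \<in> F1 \<longleftrightarrow> s \<in> F2" if "s \<in> states PS1" "s \<in> states PS2" for s
    using D that unfolding dominated_disagreement_def by blast
  show ?thesis
    using s
  proof (induction n arbitrary: s)
    case 0
    then show ?case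
      using target_iff[of s] by (auto simp: indicator_def eventual_reach_target)
  next
    case (Suc n)
    let ?K = "\<lambda>s. snd (A s)" and ?L = "\<lambda>s. snd (B s)"
    \<comment> \<open>Proved first for all states of agreement: at a point of disagreement it is
      needed for \<open>t s\<close> at the same horizon \<open>Suc n\<close>, out of reach of the
      induction hypothesis.\<close>
    have agree: "bounded_reach ?K F1 (Suc n) s \<le> eventual_reach ?L F2 s"
      if s: "s \<in> states PS1" "s \<in> states PS2" "\<not> disagreement PS1 PS2 s" for s
    proof (cases "s \<in> F1")
      case True
      then show ?thesis using target_iff s by (simp add: eventual_reach_target)
    next
      case False
      have "(\<integral>\<^sup>+x. bounded_reach ?K F1 n x \<partial>measure_pmf (?K s)) \<le>
          (\<integral>\<^sup>+x. eventual_reach ?L F2 x \<partial>measure_pmf (?L s))"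
        \<comment> \<open>Both integrals are now over one distribution, and its support lies in both
          systems, so the induction hypothesis applies there.\<close>
        unfolding same[OF s]
      proof (rule nn_integral_mono_AE, rule AE_pmfI)
        fix x assume "x \<in> set_pmf (?L s)"
        then have "x \<in> states PS1" "x \<in> states PS2"
          using set_pmf_adversary_subset[OF sys(1) A s(1)]
            set_pmf_adversary_subset[OF sys(2) B s(2)] same[OF s] by auto
        then show "bounded_reach ?K F1 n x \<le> eventual_reach ?L F2 x" by (rule Suc.IH)
      qed
      then show ?thesis
        using False target_iff[OF s(1,2)] by (simp add: eventual_reach_step[of s])
    qed
    show ?case
    proof (cases "disagreement PS1 PS2 s")
      case False
      then show ?thesis using agree Suc.prems by blast
    next
      case True
      have t: "t s \<in> states PS1" "t s \<in> states PS2" "\<not> disagreement PS1 PS2 (t s)"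
          "det_dom PS1 s (t s)" "det_dom PS2 s (t s)"
        and no_target: "\<And>u. lies_on_path PS1 s (t s) u \<Longrightarrow> u \<in> F1 \<Longrightarrow> s \<in> F1 \<or> t s \<in> F1"
        using D True unfolding dominated_disagreement_def by blast+
      show ?thesis
      proof (cases "s \<in> F1")
        case True
        then show ?thesis using target_iff Suc.prems by (simp add: eventual_reach_target)
      next
        case s: False
        \<comment> \<open>Either \<open>t s\<close> is a target and the right side is 1, or every
          path from \<open>s\<close> to \<open>t s\<close> avoids the target.\<close>
        have "bounded_reach ?K F1 (Suc n) s \<le> bounded_reach ?K F1 (Suc n) (t s)"
        proof (cases "t s \<in> F1")
          case True
          then show ?thesis using bounded_reach_le_1[of ?K F1 "Suc n" s] by simp
        next
          case False
          then show ?thesis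
            using t no_target s A by (intro det_dom_bounded_reach_le) blast+
        qed
        also have "\<dots> \<le> eventual_reach ?L F2 (t s)"
          using t by (intro agree) auto
        \<comment> \<open>Domination in the second system, where the chain from \<open>s\<close>
          cannot avoid \<open>t s\<close> except by hitting a target earlier.\<close>
        also have "\<dots> \<le> eventual_reach ?L F2 s"
          using t B by (intro det_dom_eventual_reach_mono) auto
        finally show ?thesis .
      qed
    qed
  qed
qed

lemma eventual_reach_le_other:
  assumes "dominated_disagreement PS1 PS2 F1 F2 t"
    and "prob_system PS1" "prob_system PS2"
    and "A \<in> adversaries PS1" "B \<in> adversaries PS2"
    and "\<And>s. s \<in> states PS1 \<Longrightarrow> s \<in> states PS2 \<Longrightarrow> \<not> disagreement PS1 PS2 s \<Longrightarrow>
      snd (A s) = snd (B s)"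
    and "s \<in> states PS1" "s \<in> states PS2"
  shows "eventual_reach (\<lambda>s. snd (A s)) F1 s \<le> eventual_reach (\<lambda>s. snd (B s)) F2 s"
  unfolding eventual_reach_def[of _ F1] by (intro SUP_least bounded_reach_le_other[OF assms])

section \<open>Copying choices between the systems\<close>

text \<open>Agreement ignores labels, so only the distribution of each choice can be copied.
  Elsewhere any available step serves.\<close>

lemma obtain_transferred_adversary:
  assumes A: "A \<in> adversaries PS1"
    and steps_ne: "\<forall>s\<in>states PS2. steps PS2 s \<noteq> {}"
  obtains B where "B \<in> adversaries PS2"
    "\<And>s. s \<in> states PS1 \<Longrightarrow> s \<in> states PS2 \<Longrightarrow> \<not> disagreement PS1 PS2 s \<Longrightarrow>
      snd (A s) = snd (B s)"
proof -
  have "\<exists>b\<in>steps PS2 s. s \<in> states PS1 \<longrightarrow> \<not> disagreement PS1 PS2 s \<longrightarrow> snd (A s) = snd b"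
    if s: "s \<in> states PS2" for s
  proof (cases "s \<in> states PS1 \<and> \<not> disagreement PS1 PS2 s")
    case True
    then have "snd ` steps PS1 s = snd ` steps PS2 s"
      using s by (simp add: disagreement_def steps_equiv_iff)
    moreover have "snd (A s) \<in> snd ` steps PS1 s"
      using True adversary_in_steps[OF A] by blast
    ultimately have "snd (A s) \<in> snd ` steps PS2 s" by simp
    then show ?thesis by blast
  next
    case False
    then show ?thesis using steps_ne s by blast
  qed
  then obtain b where b: "\<And>s. s \<in> states PS2 \<Longrightarrow> b s \<in> steps PS2 s \<and>
      (s \<in> states PS1 \<longrightarrow> \<not> disagreement PS1 PS2 s \<longrightarrow> snd (A s) = snd (b s))"
    by metis
  show ?thesis
  \<comment> \<open>Adversaries are extensional functions, hence the restriction to the state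
    set.\<close>
  proof (rule that[of "restrict b (states PS2)"])
    show "restrict b (states PS2) \<in> adversaries PS2"
      using b by (auto simp: adversaries_def)
  qed (use b in auto)
qed

lemma ProbReach_image_subset:
  assumes D: "dominated_disagreement PS1 PS2 F1 F2 t"
    and sys: "prob_system PS1" "prob_system PS2"
    and start_eq: "start PS1 = start PS2"
    and steps_ne: "\<forall>s\<in>states PS2. steps PS2 s \<noteq> {}"
  shows "(\<lambda>A. ProbReach PS1 A F1) ` adversaries PS1 \<subseteq> (\<lambda>A. ProbReach PS2 A F2) ` adversaries PS2"
proof (rule image_subsetI)
  fix A assume A: "A \<in> adversaries PS1"
  obtain B where B: "B \<in> adversaries PS2"
    "\<And>s. s \<in> states PS1 \<Longrightarrow> s \<in> states PS2 \<Longrightarrow> \<not> disagreement PS1 PS2 s \<Longrightarrow>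
      snd (A s) = snd (B s)"
    using obtain_transferred_adversary[OF A steps_ne] by blast
  have start: "start PS1 \<in> states PS1" "start PS1 \<in> states PS2"
    using sys start_eq by (simp_all add: prob_system_def)
  have "eventual_reach (\<lambda>s. snd (A s)) F1 (start PS1) = eventual_reach (\<lambda>s. snd (B s)) F2 (start PS1)"
  proof (rule antisym)
    show "eventual_reach (\<lambda>s. snd (A s)) F1 (start PS1) \<le>
        eventual_reach (\<lambda>s. snd (B s)) F2 (start PS1)"
      by (rule eventual_reach_le_other[OF D sys A B start])
    \<comment> \<open>The same comparison with the systems exchanged; matching choices at states of
      agreement is a symmetric relation between \<open>A\<close> and \<open>B\<close>.\<close>
    show "eventual_reach (\<lambda>s. snd (B s)) F2 (start PS1) \<le>
        eventual_reach (\<lambda>s. snd (A s)) F1 (start PS1)"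
      using B(2) disagreement_sym[of PS1 PS2] start
      by (intro eventual_reach_le_other[OF dominated_disagreement_sym[OF D] sys(2,1) B(1) A]) auto
  qed
  then have "ProbReach PS1 A F1 = ProbReach PS2 B F2"
    by (simp add: ProbReach_eq_eventual_reach start_eq)
  then show "ProbReach PS1 A F1 \<in> (\<lambda>A. ProbReach PS2 A F2) ` adversaries PS2"
    using B(1) by blast
qed

text \<open>The function \<open>t\<close> fixes one dominating state per point of disagreement, so
  that the condition on paths speaks of the very state postulated for domination. Nonempty step sets
  ensure that adversaries exist.\<close>

theorem theorem1:
  fixes PS1 PS2 :: "('s, 'l) prob_sys" and F1 F2 :: "'s set" and t :: "'s \<Rightarrow> 's"
  assumes "prob_system PS1" and "prob_system PS2"
    and "start PS1 = start PS2" and "labels PS1 = labels PS2"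
    and "\<forall>s\<in>states PS1. steps PS1 s \<noteq> {}" and "\<forall>s\<in>states PS2. steps PS2 s \<noteq> {}"
    and "F1 \<subseteq> states PS1" and "F2 \<subseteq> states PS2"
    and cond1: "\<forall>s \<in> states PS1 \<inter> states PS2. disagreement PS1 PS2 s \<longrightarrow>
           t s \<in> states PS1 \<inter> states PS2 \<and> \<not> disagreement PS1 PS2 (t s) \<and>
           det_dom PS1 s (t s) \<and> det_dom PS2 s (t s)"
    and cond2a: "states PS1 \<inter> states PS2 \<inter> F1 = states PS1 \<inter> states PS2 \<inter> F2"
    and cond2b: "\<forall>s \<in> states PS1 \<inter> states PS2. disagreement PS1 PS2 s \<longrightarrow>
           (\<forall>u. lies_on_path PS1 s (t s) u \<longrightarrow> u \<in> F1 \<longrightarrow> s \<in> F1 \<or> t s \<in> F1) \<and>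
           (\<forall>u. lies_on_path PS2 s (t s) u \<longrightarrow> u \<in> F2 \<longrightarrow> s \<in> F2 \<or> t s \<in> F2)"
  shows "MaxProbReach PS1 F1 = MaxProbReach PS2 F2 \<and> MinProbReach PS1 F1 = MinProbReach PS2 F2"
proof -
  have "s \<in> states PS1 \<inter> states PS2" if "disagreement PS1 PS2 s" for s
    using that by (simp add: disagreement_def)
  then have D: "dominated_disagreement PS1 PS2 F1 F2 t"
    unfolding dominated_disagreement_def using cond1 cond2a cond2b by blast
  \<comment> \<open>Equality of the whole sets of attainable values settles supremum and infimum
    together, whether or not they are attained.\<close>
  have "(\<lambda>A. ProbReach PS1 A F1) ` adversaries PS1 = (\<lambda>A. ProbReach PS2 A F2) ` adversaries PS2"
    using ProbReach_image_subset[OF D assms(1-3,6)]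
      ProbReach_image_subset[OF dominated_disagreement_sym[OF D] assms(2,1) assms(3)[symmetric] assms(5)]
    by (rule antisym)
  then show ?thesis
    by (simp add: MaxProbReach_def MinProbReach_def)
qed

end
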